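(* Let $\Pi=([n],\preceq)$ be a finite nonempty poset. The chain polytope $\mathcal{C}(\Pi)$ is indecomposable if and only if the comparability graph $\mathrm{Comp}(\Pi)$ is connected.
   Context: $[n]=\{1,\dots,n\}$. The chain polytope $\mathcal{C}(\Pi)$ is the set of all $x\in[0,1]^n$ such that $x_{a_1}+x_{a_2}+\cdots+x_{a_k}\le 1$ for all chains $a_1\prec a_2\prec\cdots\prec a_k$ of $\Pi$. The comparability graph $\mathrm{Comp}(\Pi)$ is the undirected simple graph on $[n]$ with an edge $ab$ whenever $a\prec b$ or $b\prec a$. The Minkowski sum is $Q+R=\{q+r: q\in Q, r\in R\}$. Two polytopes are homothetic if one is obtained from the other by a translation and a dilation with positive factor. A polytope $P$ is decomposable if there are polytopes $Q,R$ with $P=Q+R$ such that neither $Q$ nor $R$ is homothetic to $P$; otherwise $P$ is indecomposable. *)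

theory Defs
  imports
    "HOL-Analysis.Analysis"
    "Graph_Theory.Digraph_Component"
begin

(* unqualified "connected" stays the topological notion *)
hide_const (open) Digraph_Component.connected

text \<open>
  The ground set is a finite type \<open>'n\<close> with \<open>n = CARD('n) \<ge> 1\<close> elements, and the poset is its
  reflexive order relation \<open>r\<close>, so that \<open>a \<prec> b\<close> reads \<open>(a, b) \<in> r - Id\<close>.
\<close>

definition chain_polytope :: "'n::finite rel \<Rightarrow> (real ^ 'n) set" where
  "chain_polytope r =
    {x. (\<forall>i. x $ i \<in> {0..1}) \<and>
        (\<forall>as. sorted_wrt (\<lambda>a b. (a, b) \<in> r - Id) as \<longrightarrow> (\<Sum>a\<leftarrow>as. x $ a) \<le> 1)}"

text \<open>Undirected graphs are represented by symmetric digraphs: each edge gives two opposite arcs.\<close>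

definition comparability_graph :: "'n rel \<Rightarrow> 'n pair_pre_digraph" where
  "comparability_graph r =
    \<lparr>pverts = UNIV, parcs = {(a, b). (a, b) \<in> r - Id \<or> (b, a) \<in> r - Id}\<rparr>"

text \<open>This relation is symmetric, since \<open>x \<mapsto> t + c x\<close> with \<open>c > 0\<close> is invertible.\<close>

definition homothetic :: "'a::real_vector set \<Rightarrow> 'a set \<Rightarrow> bool" where
  "homothetic Q P \<longleftrightarrow> (\<exists>c>0. \<exists>t. Q = (\<lambda>x. t + c *\<^sub>R x) ` P)"

definition decomposable :: "'a::real_vector set \<Rightarrow> bool" where
  "decomposable P \<longleftrightarrow> polytope P \<and>
    (\<exists>Q R. polytope Q \<and> polytope R \<and> P = Q + R \<and> \<not> homothetic Q P \<and> \<not> homothetic R P)"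

definition indecomposable :: "'a::real_vector set \<Rightarrow> bool" where
  "indecomposable P \<longleftrightarrow> polytope P \<and> \<not> decomposable P"

end

theory Submission
  imports Defs
begin

text \<open>
  Write \<open>P\<close> for the chain polytope and \<open>e\<^sub>i\<close> for the unit vectors; \<open>P\<close> contains \<open>0\<close> and every
  \<open>e\<^sub>i\<close>.

  If the comparability graph is disconnected, some set \<open>A\<close> other than the empty set and the whole
  ground set is a union of components. Every chain lies in \<open>A\<close> or in its complement, so \<open>P\<close> is the
  product of its coordinate projections to \<open>A\<close> and to the complement, that is, their Minkowski sum
  (\<open>chain_polytope_eq_restrict_plus\<close>). A set homothetic to \<open>P\<close> is constant in no coordinate, whereas
  each projection is constant in the coordinates that it kills.

  Now let the graph be connected and \<open>P = Q + R\<close>. After a translation, \<open>0\<close> lies in \<open>Q\<close> and in \<open>R\<close>,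
  so both are contained in \<open>P\<close> and are nonnegative. Hence a decomposition of \<open>e\<^sub>i\<close> has the form
  \<open>e\<^sub>i = a\<^sub>i e\<^sub>i + (1 - a\<^sub>i) e\<^sub>i\<close> with the two terms in \<open>Q\<close> and \<open>R\<close>. If \<open>i\<close> and \<open>j\<close> are comparable,
  then \<open>a\<^sub>i e\<^sub>i + (1 - a\<^sub>j) e\<^sub>j\<close> lies in \<open>P\<close>, and the inequality \<open>x\<^sub>i + x\<^sub>j \<le> 1\<close> gives \<open>a\<^sub>i \<le> a\<^sub>j\<close>. By
  connectedness all \<open>a\<^sub>i\<close> equal one number \<open>\<lambda>\<close>. For a chain through \<open>i\<close> and \<open>q \<in> Q\<close>, the chain
  inequality at \<open>q + (1 - \<lambda>) e\<^sub>i\<close> bounds the chain sum of \<open>q\<close> by \<open>\<lambda>\<close>; thus \<open>Q \<subseteq> \<lambda>P\<close>, and likewise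
  \<open>R \<subseteq> (1 - \<lambda>)P\<close> (\<open>chain_polytope_summands_le\<close>). These inclusions are equalities when the factor is
  positive, because an extreme point \<open>x\<close> of \<open>P\<close> can be written as \<open>\<lambda>p + (1 - \<lambda>)p'\<close> with \<open>p\<close>, \<open>p'\<close> in
  \<open>P\<close> only for \<open>\<lambda>p = \<lambda>x\<close> (\<open>summand_eq_scaleR\<close>). So \<open>Q\<close> or \<open>R\<close> is homothetic to \<open>P\<close>.
\<close>

section \<open>Connectedness of the comparability graph\<close>

lemma comparability_graph_arc_iff:
  "(a, b) \<in> parcs (comparability_graph r) \<longleftrightarrow> (a, b) \<in> r - Id \<or> (b, a) \<in> r - Id"
  by (simp add: comparability_graph_def)

text \<open>
  Sets of vertices closed under adjacency are the form of connectedness that fits both directions: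
  such a set splits the polytope in the disconnected case, and in the connected case the vertices
  sharing one value of a function that is constant along arcs form such a set.
\<close>

lemma connected_comparability_graph_iff:
  "Digraph_Component.connected (with_proj (comparability_graph r)) \<longleftrightarrow>
    (\<forall>A. A \<noteq> {} \<longrightarrow> (\<forall>a\<in>A. \<forall>b. (a, b) \<in> parcs (comparability_graph r) \<longrightarrow> b \<in> A) \<longrightarrow> A = UNIV)"
  (is "?conn \<longleftrightarrow> ?closed")
proof -
  let ?E = "parcs (comparability_graph r)"
  have verts: "pverts (comparability_graph r) = UNIV"
    by (simp add: comparability_graph_def)
  have arcs: "parcs (mk_symmetric (with_proj (comparability_graph r))) = ?E"
    by (auto simp: parcs_mk_symmetric comparability_graph_def)
  have conn: "?conn \<longleftrightarrow> (\<forall>u v. (u, v) \<in> rtrancl_on UNIV ?E)"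
    by (simp add: Digraph_Component.connected_def strongly_connected_def reachable_def verts arcs)
  show ?thesis
  proof
    assume ?conn
    show ?closed
    proof (intro allI impI)
      fix A assume "A \<noteq> {}" and closed: "\<forall>a\<in>A. \<forall>b. (a, b) \<in> ?E \<longrightarrow> b \<in> A"
      then obtain u where "u \<in> A" by blast
      have "v \<in> A" if "(u, v) \<in> rtrancl_on UNIV ?E" for v
        using that \<open>u \<in> A\<close> by induction (use closed in auto)
      then show "A = UNIV" using \<open>?conn\<close> conn by blast
    qed
  next
    assume closed: ?closed
    have "(u, v) \<in> rtrancl_on UNIV ?E" for u v
    proof -
      have "{w. (u, w) \<in> rtrancl_on UNIV ?E} = UNIV"
      proof (rule closed[rule_format])
        show "{w. (u, w) \<in> rtrancl_on UNIV ?E} \<noteq> {}"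
          by (auto intro: rtrancl_on_refl)
      qed (auto intro: rtrancl_on_into_rtrancl_on)
      then show ?thesis by auto
    qed
    then show ?conn using conn by blast
  qed
qed

section \<open>The chain polytope\<close>

lemma chain_polytope_nonneg: "x \<in> chain_polytope r \<Longrightarrow> 0 \<le> x $ i"
  and chain_polytope_le_one: "x \<in> chain_polytope r \<Longrightarrow> x $ i \<le> 1"
  and chain_polytope_chain_le: "x \<in> chain_polytope r \<Longrightarrow>
    sorted_wrt (\<lambda>a b. (a, b) \<in> r - Id) as \<Longrightarrow> (\<Sum>a\<leftarrow>as. x $ a) \<le> 1"
  by (auto simp: chain_polytope_def)

lemma distinct_chain: "sorted_wrt (\<lambda>a b. (a, b) \<in> r - Id) as \<Longrightarrow> distinct as"
  by (induction as) auto

text \<open>Singletons are chains, so the chain inequalities contain the upper bounds on the coordinates.\<close>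

lemma chain_polytopeI:
  assumes "\<And>i. 0 \<le> x $ i"
    and "\<And>as. sorted_wrt (\<lambda>a b. (a, b) \<in> r - Id) as \<Longrightarrow> (\<Sum>a\<leftarrow>as. x $ a) \<le> 1"
  shows "x \<in> chain_polytope r"
  using assms(1) assms(2) assms(2)[of "[i]" for i] by (auto simp: chain_polytope_def)

lemma zero_mem_chain_polytope: "0 \<in> chain_polytope r"
  by (rule chain_polytopeI) auto

lemma axis_mem_chain_polytope: "axis i 1 \<in> chain_polytope r"
proof (rule chain_polytopeI)
  fix as :: "'a list" assume "sorted_wrt (\<lambda>a b. (a, b) \<in> r - Id) as"
  then have "(\<Sum>a\<leftarrow>as. axis i (1::real) $ a) = (\<Sum>a\<in>set as. axis i 1 $ a)"
    by (simp add: sum_list_distinct_conv_sum_set distinct_chain)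
  also have "\<dots> \<le> 1"
    by (simp add: axis_def)
  finally show "(\<Sum>a\<leftarrow>as. axis i (1::real) $ a) \<le> 1" .
qed (simp add: axis_def)

lemma chain_polytope_arc_le:
  assumes "x \<in> chain_polytope r" and "(i, j) \<in> parcs (comparability_graph r)"
  shows "x $ i + x $ j \<le> 1"
  using assms(2) chain_polytope_chain_le[OF assms(1), of "[i, j]"]
    chain_polytope_chain_le[OF assms(1), of "[j, i]"]
  by (auto simp: comparability_graph_arc_iff)

lemma polytope_chain_polytope:
  fixes r :: "'n::finite rel"
  shows "polytope (chain_polytope r)"
proof -
  let ?chains = "{set as |as. sorted_wrt (\<lambda>a b. (a, b) \<in> r - Id) as}"
  have halfspaces: "polyhedron {x :: real ^ 'n. (\<Sum>a\<in>C. x $ a) \<le> 1}" for C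
  proof -
    have "(\<Sum>a\<in>C. x $ a) = (\<Sum>a\<in>C. axis a 1) \<bullet> x" for x :: "real ^ 'n"
      by (simp add: inner_sum_left inner_axis')
    then show ?thesis by (simp add: polyhedron_halfspace_le)
  qed
  have orthant: "polyhedron {x :: real ^ 'n. 0 \<le> x $ i}" for i
    using polyhedron_halfspace_ge[where a = "axis i 1 :: real ^ 'n" and b = 0] by (simp add: inner_axis')
  \<comment> \<open>Indexing the chain inequalities by sets of vertices makes their number visibly finite.\<close>
  have eq: "chain_polytope r =
    (\<Inter>C\<in>?chains. {x. (\<Sum>a\<in>C. x $ a) \<le> 1}) \<inter> (\<Inter>i. {x. 0 \<le> x $ i})" (is "_ = ?R")
  proof (intro subset_antisym subsetI)
    fix x assume x: "x \<in> chain_polytope r"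
    have "(\<Sum>a\<in>set as. x $ a) \<le> 1" if "sorted_wrt (\<lambda>a b. (a, b) \<in> r - Id) as" for as
      using chain_polytope_chain_le[OF x that]
      by (simp add: sum_list_distinct_conv_sum_set distinct_chain[OF that])
    then show "x \<in> ?R" using chain_polytope_nonneg[OF x] by blast
  next
    fix x assume x: "x \<in> ?R"
    show "x \<in> chain_polytope r"
    proof (rule chain_polytopeI)
      fix as assume as: "sorted_wrt (\<lambda>a b. (a, b) \<in> r - Id) as"
      with x have "(\<Sum>a\<in>set as. x $ a) \<le> 1" by blast
      then show "(\<Sum>a\<leftarrow>as. x $ a) \<le> 1"
        by (simp add: sum_list_distinct_conv_sum_set distinct_chain[OF as])
    qed (use x in auto)
  qed
  have "polyhedron (chain_polytope r)"
    unfolding eq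
    by (intro polyhedron_Int polyhedron_Inter) (auto simp: halfspaces orthant)
  moreover have "bounded (chain_polytope r)"
  proof (rule bounded_subset[OF bounded_cbox])
    show "chain_polytope r \<subseteq> cbox 0 1"
      by (auto simp: mem_box_cart chain_polytope_nonneg chain_polytope_le_one)
  qed
  ultimately show ?thesis by (simp add: polytope_eq_bounded_polyhedron)
qed

section \<open>Disconnected comparability graphs\<close>

definition restrict_vec :: "'n set \<Rightarrow> real ^ 'n::finite \<Rightarrow> real ^ 'n" where
  "restrict_vec A x = (\<chi> i. if i \<in> A then x $ i else 0)"

lemma linear_restrict_vec: "linear (restrict_vec A)"
  by (rule linearI) (auto simp: restrict_vec_def vec_eq_iff)

lemma polytope_restrict_chain_polytope: "polytope (restrict_vec A ` chain_polytope r)"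
  by (intro polytope_linear_image linear_restrict_vec polytope_chain_polytope)

text \<open>
  A chain meets only one side of a partition into unions of components, so its inequality for a
  sum of restrictions reduces to that of one of the two summands.
\<close>

lemma chain_polytope_eq_restrict_plus:
  assumes closed: "\<And>a b. (a, b) \<in> parcs (comparability_graph r) \<Longrightarrow> a \<in> A \<longleftrightarrow> b \<in> A"
  shows "chain_polytope r = restrict_vec A ` chain_polytope r + restrict_vec (- A) ` chain_polytope r"
    (is "?P = ?Q + ?R")
proof (intro subset_antisym subsetI)
  fix x assume "x \<in> ?P"
  moreover have "x = restrict_vec A x + restrict_vec (- A) x"
    by (simp add: restrict_vec_def vec_eq_iff)
  ultimately show "x \<in> ?Q + ?R" by (metis imageI set_plus_intro)
next
  fix z assume "z \<in> ?Q + ?R"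
  then obtain x y where x: "x \<in> ?P" and y: "y \<in> ?P"
    and z: "z = restrict_vec A x + restrict_vec (- A) y"
    by (auto elim!: set_plus_elim)
  show "z \<in> ?P"
  proof (rule chain_polytopeI)
    fix i show "0 \<le> z $ i"
      using x y by (simp add: z restrict_vec_def chain_polytope_nonneg)
  next
    fix as assume as: "sorted_wrt (\<lambda>a b. (a, b) \<in> r - Id) as"
    have "set as \<subseteq> A \<or> set as \<subseteq> - A"
    proof (cases as)
      case (Cons a bs)
      with as closed have "\<forall>b\<in>set bs. b \<in> A \<longleftrightarrow> a \<in> A"
        by (auto simp: comparability_graph_arc_iff)
      with Cons show ?thesis by auto
    qed simp
    moreover have "z $ a = (if a \<in> A then x $ a else y $ a)" for a
      by (simp add: z restrict_vec_def)
    ultimately have "(\<forall>a\<in>set as. z $ a = x $ a) \<or> (\<forall>a\<in>set as. z $ a = y $ a)"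
      by (metis ComplD subsetD)
    then consider "\<forall>a\<in>set as. z $ a = x $ a" | "\<forall>a\<in>set as. z $ a = y $ a"
      by blast
    then show "(\<Sum>a\<leftarrow>as. z $ a) \<le> 1"
    proof cases
      case 1
      then have "map (($) z) as = map (($) x) as" by simp
      then show ?thesis using chain_polytope_chain_le[OF x as] by metis
    next
      case 2
      then have "map (($) z) as = map (($) y) as" by simp
      then show ?thesis using chain_polytope_chain_le[OF y as] by metis
    qed
  qed
qed

lemma not_homothetic_restrict_chain_polytope:
  assumes "A \<noteq> UNIV"
  shows "\<not> homothetic (restrict_vec A ` chain_polytope r) (chain_polytope r)"
proof
  assume "homothetic (restrict_vec A ` chain_polytope r) (chain_polytope r)"
  then obtain c t where "c > 0"
    and eq: "restrict_vec A ` chain_polytope r = (\<lambda>x. t + c *\<^sub>R x) ` chain_polytope r"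
    by (auto simp: homothetic_def)
  obtain b where "b \<notin> A" using assms by blast
  then have vanish: "y $ b = 0" if "y \<in> restrict_vec A ` chain_polytope r" for y
    using that by (auto simp: restrict_vec_def)
  have "(t + c *\<^sub>R 0) $ b = 0" "(t + c *\<^sub>R axis b 1) $ b = 0"
    by (rule vanish; unfold eq; intro imageI zero_mem_chain_polytope axis_mem_chain_polytope)+
  with \<open>c > 0\<close> show False by simp
qed

lemma decomposable_chain_polytope:
  assumes "\<not> Digraph_Component.connected (with_proj (comparability_graph r))"
  shows "decomposable (chain_polytope r)"
proof -
  obtain A where "A \<noteq> {}" "A \<noteq> UNIV"
    and closed: "\<forall>a\<in>A. \<forall>b. (a, b) \<in> parcs (comparability_graph r) \<longrightarrow> b \<in> A"
    using assms connected_comparability_graph_iff[of r] by blast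
  from closed have "\<And>a b. (a, b) \<in> parcs (comparability_graph r) \<Longrightarrow> a \<in> A \<longleftrightarrow> b \<in> A"
    unfolding comparability_graph_arc_iff by blast
  note sum = chain_polytope_eq_restrict_plus[OF this]
  have "- A \<noteq> UNIV" using \<open>A \<noteq> {}\<close> by auto
  with \<open>A \<noteq> UNIV\<close> show ?thesis
    unfolding decomposable_def
    by (intro conjI exI[of _ "restrict_vec A ` chain_polytope r"]
        exI[of _ "restrict_vec (- A) ` chain_polytope r"] polytope_chain_polytope
        polytope_restrict_chain_polytope not_homothetic_restrict_chain_polytope sum)
qed

section \<open>Connected comparability graphs\<close>

text \<open>
  It suffices to find \<open>l x\<close> in \<open>Q\<close> for the extreme points \<open>x\<close> of \<open>P\<close>, whose convex hull is \<open>P\<close>. The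
  inclusions turn a decomposition of \<open>x\<close> along \<open>P = Q + R\<close> into a convex combination of points of
  \<open>P\<close> with weights \<open>l\<close> and \<open>1 - l\<close>, and extremality forces the point of weight \<open>l\<close> to be \<open>x\<close>.
\<close>

lemma summand_eq_scaleR:
  fixes P Q R :: "'a::euclidean_space set"
  assumes "compact P" "convex P" "convex Q" "P = Q + R"
    and Q: "Q \<subseteq> (\<lambda>x. l *\<^sub>R x) ` P" and R: "R \<subseteq> (\<lambda>x. (1 - l) *\<^sub>R x) ` P"
    and l: "0 < l" "l \<le> 1"
  shows "Q = (\<lambda>x. l *\<^sub>R x) ` P"
proof (rule subset_antisym[OF Q])
  have "l *\<^sub>R x \<in> Q" if x: "x extreme_point_of P" for x
  proof -
    have "x \<in> Q + R" using x \<open>P = Q + R\<close> by (simp add: extreme_point_of_def)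
    then obtain q s where q: "q \<in> Q" and s: "s \<in> R" and "x = q + s"
      by (auto elim!: set_plus_elim)
    obtain p p' where p: "p \<in> P" "q = l *\<^sub>R p" and p': "p' \<in> P" "s = (1 - l) *\<^sub>R p'"
      using q s Q R by blast
    have x_eq: "x = (1 - l) *\<^sub>R p' + l *\<^sub>R p"
      using \<open>x = q + s\<close> p p' by simp
    have "p = x"
    proof (cases "l = 1 \<or> p' = p")
      case True
      then show ?thesis using x_eq by (auto simp: algebra_simps)
    next
      case False
      then have "x \<in> open_segment p' p"
        using x_eq l by (auto simp: in_segment)
      then show ?thesis using x p p' by (simp add: extreme_point_of_def)
    qed
    with q p show ?thesis by simp
  qed
  then have "(\<lambda>x. l *\<^sub>R x) ` {x. x extreme_point_of P} \<subseteq> Q" by blast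
  then have "convex hull ((\<lambda>x. l *\<^sub>R x) ` {x. x extreme_point_of P}) \<subseteq> Q"
    using \<open>convex Q\<close> by (rule hull_minimal)
  moreover have "(\<lambda>x. l *\<^sub>R x) ` P = convex hull ((\<lambda>x. l *\<^sub>R x) ` {x. x extreme_point_of P})"
    using Krein_Milman_Minkowski[OF \<open>compact P\<close> \<open>convex P\<close>]
    by (metis convex_hull_scaling)
  ultimately show "(\<lambda>x. l *\<^sub>R x) ` P \<subseteq> Q" by simp
qed

lemma mem_scaled_chain_polytopeI:
  assumes nonneg: "\<And>i. 0 \<le> x $ i" and "0 \<le> l"
    and chains: "\<And>as. sorted_wrt (\<lambda>a b. (a, b) \<in> r - Id) as \<Longrightarrow> (\<Sum>a\<leftarrow>as. x $ a) \<le> l"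
  shows "x \<in> (\<lambda>y. l *\<^sub>R y) ` chain_polytope r"
proof (cases "l = 0")
  case True
  have "x $ i = 0" for i
    using nonneg[of i] chains[of "[i]"] True by simp
  then have "x = l *\<^sub>R 0" by (simp add: vec_eq_iff)
  then show ?thesis using zero_mem_chain_polytope by blast
next
  case False
  with \<open>0 \<le> l\<close> have "0 < l" by simp
  have "x /\<^sub>R l \<in> chain_polytope r"
  proof (rule chain_polytopeI)
    fix as assume "sorted_wrt (\<lambda>a b. (a, b) \<in> r - Id) as"
    then have "(\<Sum>a\<leftarrow>as. x $ a) \<le> l" by (rule chains)
    moreover have "(\<Sum>a\<leftarrow>as. (x /\<^sub>R l) $ a) = inverse l * (\<Sum>a\<leftarrow>as. x $ a)"
      by (simp add: sum_list_const_mult)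
    moreover have "inverse l * (\<Sum>a\<leftarrow>as. x $ a) \<le> 1" if "(\<Sum>a\<leftarrow>as. x $ a) \<le> l"
      using that \<open>0 < l\<close> by (simp add: field_simps)
    ultimately show "(\<Sum>a\<leftarrow>as. (x /\<^sub>R l) $ a) \<le> 1"
      by simp
  qed (use nonneg \<open>0 < l\<close> in simp)
  moreover have "x = l *\<^sub>R (x /\<^sub>R l)" using False by simp
  ultimately show ?thesis by blast
qed

text \<open>
  The chain inequality at \<open>q + (1 - l) e\<^sub>i\<close>, where \<open>i\<close> belongs to the chain, leaves only \<open>l\<close> for the
  chain sum of \<open>q\<close>.
\<close>

lemma summand_subset_scaled_chain_polytope:
  assumes sum: "\<And>q s. q \<in> Q \<Longrightarrow> s \<in> R \<Longrightarrow> q + s \<in> chain_polytope r"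
    and "0 \<in> R" and axes: "\<And>i. axis i (1 - l) \<in> R" and l: "0 \<le> l" "l \<le> 1"
  shows "Q \<subseteq> (\<lambda>x. l *\<^sub>R x) ` chain_polytope r"
proof
  fix q assume q: "q \<in> Q"
  show "q \<in> (\<lambda>x. l *\<^sub>R x) ` chain_polytope r"
  proof (rule mem_scaled_chain_polytopeI)
    show "0 \<le> q $ i" for i
      using sum[OF q \<open>0 \<in> R\<close>] by (simp add: chain_polytope_nonneg)
  next
    fix as assume as: "sorted_wrt (\<lambda>a b. (a, b) \<in> r - Id) as"
    show "(\<Sum>a\<leftarrow>as. q $ a) \<le> l"
    proof (cases as)
      case (Cons i bs)
      have "(\<Sum>a\<leftarrow>bs. q $ a) \<le> (\<Sum>a\<leftarrow>bs. (q + axis i (1 - l)) $ a)"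
        using l by (intro sum_list_mono) (simp add: axis_def)
      moreover have "(\<Sum>a\<leftarrow>as. (q + axis i (1 - l)) $ a) \<le> 1"
        by (rule chain_polytope_chain_le[OF sum[OF q axes] as])
      ultimately show ?thesis using Cons by simp
    qed (use l in simp)
  qed (use l in simp)
qed

text \<open>
  The factor \<open>l\<close> is the common value of the coefficients by which the unit vectors split between
  \<open>Q\<close> and \<open>R\<close>; nonnegativity makes each unit vector split along its own axis, and the inequality
  of a two-element chain compares the coefficients of adjacent vertices.
\<close>

lemma chain_polytope_summands_le:
  assumes "Digraph_Component.connected (with_proj (comparability_graph r))"
    and sum: "chain_polytope r = Q + R" and "0 \<in> Q" "0 \<in> R"
  obtains l where "0 \<le> l" "l \<le> 1" "Q \<subseteq> (\<lambda>x. l *\<^sub>R x) ` chain_polytope r"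
    "R \<subseteq> (\<lambda>x. (1 - l) *\<^sub>R x) ` chain_polytope r"
proof -
  have mem: "q + s \<in> chain_polytope r" if "q \<in> Q" "s \<in> R" for q s
    using that by (auto simp: sum)
  have "\<exists>a. 0 \<le> a \<and> a \<le> 1 \<and> axis i a \<in> Q \<and> axis i (1 - a) \<in> R" for i
  proof -
    have "axis i 1 \<in> Q + R" using axis_mem_chain_polytope sum by metis
    then obtain q s where q: "q \<in> Q" and s: "s \<in> R" and qs: "axis i 1 = q + s"
      by (auto elim!: set_plus_elim)
    have "q \<in> chain_polytope r" "s \<in> chain_polytope r"
      using mem[OF q \<open>0 \<in> R\<close>] mem[OF \<open>0 \<in> Q\<close> s] by simp_all
    then have nonneg: "0 \<le> q $ j" "0 \<le> s $ j" for j
      by (simp_all add: chain_polytope_nonneg)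
    have coord: "q $ j + s $ j = (if j = i then 1 else 0)" for j
      using arg_cong[OF qs, of "\<lambda>x. x $ j"] by (simp add: axis_def)
    have off: "q $ j = 0" "s $ j = 0" if "j \<noteq> i" for j
      using nonneg[of j] coord[of j] that by simp_all
    have "s $ i = 1 - q $ i"
      using coord[of i] by simp
    with off have "q = axis i (q $ i)" "s = axis i (1 - q $ i)"
      by (auto simp: vec_eq_iff axis_def)
    then show ?thesis using q s nonneg[of i] coord[of i] by (intro exI[of _ "q $ i"]) auto
  qed
  then obtain a where a: "0 \<le> a i" "a i \<le> 1" "axis i (a i) \<in> Q" "axis i (1 - a i) \<in> R" for i
    by metis
  have le: "a i \<le> a j" if arc: "(i, j) \<in> parcs (comparability_graph r)" for i j
  proof -
    have "i \<noteq> j" using arc by (auto simp: comparability_graph_arc_iff)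
    have "axis i (a i) + axis j (1 - a j) \<in> chain_polytope r"
      by (rule mem) (rule a)+
    from chain_polytope_arc_le[OF this arc] \<open>i \<noteq> j\<close> show ?thesis
      by (simp add: axis_def)
  qed
  \<comment> \<open>The value at an arbitrary vertex.\<close>
  define l where "l = a undefined"
  \<comment> \<open>The arcs come in opposite pairs, so \<open>a\<close> is constant along arcs.\<close>
  have "{i. a i = l} = UNIV"
  proof (rule assms(1)[unfolded connected_comparability_graph_iff, rule_format])
    show "{i. a i = l} \<noteq> {}" by (auto simp: l_def)
  next
    fix i j assume "i \<in> {i. a i = l}" and arc: "(i, j) \<in> parcs (comparability_graph r)"
    moreover have "(j, i) \<in> parcs (comparability_graph r)"
      using arc by (auto simp: comparability_graph_arc_iff)
    ultimately show "j \<in> {i. a i = l}" using le by (auto intro: order_antisym)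
  qed
  then have const: "a i = l" for i by blast
  have axes: "axis i l \<in> Q" "axis i (1 - l) \<in> R" for i
    using a[of i] by (simp_all add: const)
  have bounds: "0 \<le> l" "l \<le> 1" by (simp_all add: l_def a)
  show thesis
  proof
    show "Q \<subseteq> (\<lambda>x. l *\<^sub>R x) ` chain_polytope r"
      by (rule summand_subset_scaled_chain_polytope[OF mem \<open>0 \<in> R\<close> axes(2) bounds])
    have mem': "s + q \<in> chain_polytope r" if "s \<in> R" "q \<in> Q" for s q
      using mem[OF that(2,1)] by (simp add: add.commute)
    show "R \<subseteq> (\<lambda>x. (1 - l) *\<^sub>R x) ` chain_polytope r"
      by (rule summand_subset_scaled_chain_polytope[OF mem' \<open>0 \<in> Q\<close>])
        (use axes(1) bounds in simp_all)
  qed (fact bounds)+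
qed

lemma homothetic_scaleR: "c > 0 \<Longrightarrow> homothetic ((\<lambda>x. c *\<^sub>R x) ` P) P"
  unfolding homothetic_def by (rule exI[of _ c]) (auto intro: exI[of _ 0])

lemma homothetic_of_translate:
  assumes "homothetic ((\<lambda>x. x - v) ` Q) P"
  shows "homothetic Q P"
proof -
  obtain c t where "c > 0" and eq: "(\<lambda>x. x - v) ` Q = (\<lambda>x. t + c *\<^sub>R x) ` P"
    using assms by (auto simp: homothetic_def)
  have "Q = (\<lambda>x. x + v) ` ((\<lambda>x. x - v) ` Q)" by (simp add: image_image)
  also have "\<dots> = (\<lambda>x. (t + v) + c *\<^sub>R x) ` P" by (simp add: eq image_image algebra_simps)
  finally show ?thesis using \<open>c > 0\<close> by (auto simp: homothetic_def)
qed

text \<open>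
  The origin splits as \<open>0 = v + w\<close>, so translating \<open>Q\<close> by \<open>-v\<close> and \<open>R\<close> by \<open>-w\<close> keeps the sum and
  brings \<open>0\<close> into both. For \<open>l > 0\<close> the translate of \<open>Q\<close> is \<open>l\<close> times the polytope; for \<open>l = 0\<close> it is
  a point, and the translate of \<open>R\<close> is the polytope itself.
\<close>

lemma chain_polytope_summand_homothetic:
  assumes conn: "Digraph_Component.connected (with_proj (comparability_graph r))"
    and "convex Q" "convex R" and sum: "chain_polytope r = Q + R"
  shows "homothetic Q (chain_polytope r) \<or> homothetic R (chain_polytope r)"
proof -
  let ?P = "chain_polytope r"
  have P: "compact ?P" "convex ?P"
    using polytope_chain_polytope by (blast intro: polytope_imp_compact polytope_imp_convex)+
  have "0 \<in> Q + R" using zero_mem_chain_polytope sum by metis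
  then obtain v w where v: "v \<in> Q" and w: "w \<in> R" and vw: "0 = v + w"
    by (auto elim!: set_plus_elim)
  define Q' R' where "Q' = (\<lambda>x. x - v) ` Q" and "R' = (\<lambda>x. x - w) ` R"
  have convex: "convex Q'" "convex R'"
    using \<open>convex Q\<close> \<open>convex R\<close> by (simp_all add: Q'_def R'_def convex_translation_subtract)
  have zero: "0 \<in> Q'" "0 \<in> R'"
    using v w by (auto simp: Q'_def R'_def image_iff)
  have translate: "(q - v) + (s - w) = q + s" for q s
  proof -
    have "(q - v) + (s - w) = q + s - (v + w)" by simp
    then show ?thesis by (simp flip: vw)
  qed
  have "Q' + R' = Q + R"
  proof (intro subset_antisym subsetI)
    fix x assume "x \<in> Q' + R'"
    then show "x \<in> Q + R"
      by (auto elim!: set_plus_elim simp: Q'_def R'_def translate)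
  next
    fix x assume "x \<in> Q + R"
    then obtain q s where "q \<in> Q" "s \<in> R" "x = (q - v) + (s - w)"
      by (auto elim!: set_plus_elim simp: translate)
    then show "x \<in> Q' + R'" by (auto simp: Q'_def R'_def)
  qed
  then have sum': "?P = Q' + R'" using sum by simp
  obtain l where l: "0 \<le> l" "l \<le> 1" "Q' \<subseteq> (\<lambda>x. l *\<^sub>R x) ` ?P" "R' \<subseteq> (\<lambda>x. (1 - l) *\<^sub>R x) ` ?P"
    using chain_polytope_summands_le[OF conn sum' zero] .
  show ?thesis
  proof (cases "l > 0")
    case True
    with l have "Q' = (\<lambda>x. l *\<^sub>R x) ` ?P"
      by (intro summand_eq_scaleR[OF P convex(1) sum'])
    then have "homothetic Q' ?P" using True by (simp add: homothetic_scaleR)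
    then show ?thesis unfolding Q'_def by (blast dest: homothetic_of_translate)
  next
    case False
    have "?P = R' + Q'" using sum' by (simp only: add.commute)
    then have "R' = (\<lambda>x. (1 - l) *\<^sub>R x) ` ?P"
      by (rule summand_eq_scaleR[OF P convex(2)]) (use l False in simp_all)
    then have "homothetic R' ?P" using False by (simp add: homothetic_scaleR)
    then show ?thesis unfolding R'_def by (blast dest: homothetic_of_translate)
  qed
qed

theorem corollary4p16:
  fixes r :: "'n::finite rel"
  assumes "partial_order_on UNIV r"
  shows "indecomposable (chain_polytope r) \<longleftrightarrow>
    Digraph_Component.connected (with_proj (comparability_graph r))"
proof
  show "Digraph_Component.connected (with_proj (comparability_graph r))"
    if "indecomposable (chain_polytope r)"
    using that decomposable_chain_polytope by (auto simp: indecomposable_def)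
next
  assume "Digraph_Component.connected (with_proj (comparability_graph r))"
  then show "indecomposable (chain_polytope r)"
    unfolding indecomposable_def decomposable_def
    by (metis polytope_chain_polytope chain_polytope_summand_homothetic polytope_imp_convex)
qed

end
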